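(* Let $m,b,c$ be positive integers with $m>2$. (1) Let $p>2$ and $q$ be two distinct primes such that $p\mid q^{2b}+1$ and $q^{2c+1}\,\|\,(m-1)$. If $p\nmid (m-2)k$, then a $(q^{2b}+1,m,k,\lambda)$-SEDF does not exist in any abelian group. (2) Let $q$ be a prime such that $q^{2c}\,\|\,(m-1)$ or $q\nmid (m-1)$, and let $p$ be an odd prime with $p\mid q^{2b+1}+1$. If $p\nmid (m-2)k$, then a $(q^{2b+1}+1,m,k,\lambda)$-SEDF does not exist in any abelian group.
   Context: Let $G$ be a finite abelian group of order $v$ with identity $e$. A $(v,m,k,\lambda)$-SEDF in $G$ is a collection $\{D_1,\dots,D_m\}$ of pairwise disjoint $k$-subsets of $G$ such that for each $j$ the multiset $\{xy^{-1}: x\in D_\ell,\ y\in D_j,\ \ell\neq j\}$ contains every non-identity element of $G$ exactly $\lambda$ times and does not contain $e$. $q^a\| n$ means $q^a\mid n$ but $q^{a+1}\nmid n$. *)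

theory Defs
  imports "HOL-Algebra.Coset" "HOL-Library.Multiset" "HOL-Computational_Algebra.Primes"
begin

definition exact_power_dvd :: "nat \<Rightarrow> nat \<Rightarrow> nat \<Rightarrow> bool" where
  "exact_power_dvd q a n \<longleftrightarrow> q ^ a dvd n \<and> \<not> q ^ (a + 1) dvd n"

text \<open>
  The multiset of all quotients of an element of some \<open>D l\<close> by an element of \<open>D j\<close>,
  with \<open>l \<noteq> j\<close>.  The triples \<open>(l, x, y)\<close> rather than the quotients are collected in a
  set, so that every quotient is counted with its multiplicity.
\<close>

definition ext_quotients ::
  "('a, 'b) monoid_scheme \<Rightarrow> nat \<Rightarrow> (nat \<Rightarrow> 'a set) \<Rightarrow> nat \<Rightarrow> 'a multiset" where
  "ext_quotients G m D j =
     image_mset (\<lambda>(l, x, y). x \<otimes>\<^bsub>G\<^esub> inv\<^bsub>G\<^esub> y)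
       (mset_set (SIGMA l : {1..m} - {j}. D l \<times> D j))"

definition is_SEDF ::
  "('a, 'b) monoid_scheme \<Rightarrow> nat \<Rightarrow> nat \<Rightarrow> nat \<Rightarrow> nat \<Rightarrow> (nat \<Rightarrow> 'a set) \<Rightarrow> bool" where
  "is_SEDF G v m k lam D \<longleftrightarrow>
     comm_group G \<and> finite (carrier G) \<and> order G = v \<and>
     (\<forall>j \<in> {1..m}. D j \<subseteq> carrier G \<and> card (D j) = k) \<and>
     (\<forall>i \<in> {1..m}. \<forall>j \<in> {1..m}. i \<noteq> j \<longrightarrow> D i \<inter> D j = {}) \<and>
     (\<forall>j \<in> {1..m}.
        (\<forall>g \<in> carrier G - {\<one>\<^bsub>G\<^esub>}. count (ext_quotients G m D j) g = lam) \<and>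
        \<one>\<^bsub>G\<^esub> \<notin># ext_quotients G m D j)"

end

theory Submission
  imports Defs "Jordan_Normal_Form.Char_Poly" "HOL-Number_Theory.Residues"
    "HOL-Algebra.Sylow" "HOL-Algebra.Multiplicative_Group"
begin

text \<open>
  Let \<open>\<chi>\<close> be a character of \<open>G\<close> of order \<open>p\<close>, with values in \<open>\<int>[z]\<close> for a primitive \<open>p\<close>-th root of
  unity \<open>z\<close>, and put \<open>a j = \<chi>(D j)\<close>, \<open>A = \<Sum>j. a j\<close>. The SEDF condition becomes
  \<open>(A - a j) * cnj (a j) = - \<lambda>\<close> for every \<open>j\<close>.

  If \<open>A = 0\<close>, then \<open>\<bar>a j\<bar>\<^sup>2 = \<lambda>\<close>. Since \<open>-1\<close> is a power of \<open>q\<close> modulo \<open>p\<close>, complex conjugation is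
  modulo \<open>q\<close> a power of the Frobenius map, and this forces the multiplicity of \<open>q\<close> in \<open>\<lambda>\<close> to be
  even; but it is odd by \<open>(m - 1) * k\<^sup>2 = \<lambda> * (v - 1)\<close>.

  If \<open>A \<noteq> 0\<close>, the ratios \<open>a j / A\<close> are real roots of one quadratic equation \<open>r * (1 - r) = const < 0\<close>
  and sum to 1. This gives \<open>a i * (s - 1) = a j * (s + 1 - m)\<close> for some \<open>i\<close>, \<open>j\<close>, where \<open>s\<close> is the number
  of positive ratios. All \<open>a j\<close> are congruent to \<open>k\<close> modulo \<open>1 - z\<close>, so \<open>p\<close> divides \<open>k * (m - 2)\<close>.
\<close>

section \<open>The ring generated by a root of unity\<close>

text \<open>Elements of the ring Z[\<open>z\<close>] are kept as values of integer polynomials, so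
  that replacing \<open>z\<close> by \<open>z ^ q\<close> or \<open>cnj z\<close> in a chosen
  representative takes the place of a Galois automorphism.\<close>

definition int_adjoin :: "complex \<Rightarrow> complex set" where
  "int_adjoin z = range (\<lambda>f :: int poly. poly (map_poly of_int f) z)"

lemma int_adjoin_of_int [simp]: "of_int a \<in> int_adjoin z"
  unfolding int_adjoin_def by (rule range_eqI[of _ _ "[:a:]"]) (simp add: of_int_hom.map_poly_pCons_hom)

lemma int_adjoin_of_nat [simp]: "of_nat a \<in> int_adjoin z"
  using int_adjoin_of_int[of "int a" z] by simp

lemma int_adjoin_0 [simp]: "0 \<in> int_adjoin z"
  using int_adjoin_of_int[of 0 z] by simp

lemma int_adjoin_1 [simp]: "1 \<in> int_adjoin z"
  using int_adjoin_of_int[of 1 z] by simp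

lemma int_adjoin_self [simp]: "z \<in> int_adjoin z"
  unfolding int_adjoin_def by (rule range_eqI[of _ _ "[:0, 1:]"]) (simp add: map_poly_pCons)

lemma int_adjoin_add: "x \<in> int_adjoin z \<Longrightarrow> y \<in> int_adjoin z \<Longrightarrow> x + y \<in> int_adjoin z"
  unfolding int_adjoin_def
  by (auto simp: of_int_poly_hom.hom_add[symmetric] poly_add[symmetric] simp del: poly_add)

lemma int_adjoin_mult: "x \<in> int_adjoin z \<Longrightarrow> y \<in> int_adjoin z \<Longrightarrow> x * y \<in> int_adjoin z"
  unfolding int_adjoin_def
  by (auto simp: of_int_poly_hom.hom_mult[symmetric] poly_mult[symmetric] simp del: poly_mult)

lemma int_adjoin_uminus: "x \<in> int_adjoin z \<Longrightarrow> - x \<in> int_adjoin z"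
  using int_adjoin_mult[of "of_int (-1)" z x] int_adjoin_of_int[of "-1" z] by simp

lemma int_adjoin_diff: "x \<in> int_adjoin z \<Longrightarrow> y \<in> int_adjoin z \<Longrightarrow> x - y \<in> int_adjoin z"
  using int_adjoin_add[of x z "- y"] int_adjoin_uminus by simp

lemma int_adjoin_power: "x \<in> int_adjoin z \<Longrightarrow> x ^ n \<in> int_adjoin z"
  by (induction n) (simp_all add: int_adjoin_mult)

lemma int_adjoin_sum: "(\<And>i. i \<in> I \<Longrightarrow> f i \<in> int_adjoin z) \<Longrightarrow> sum f I \<in> int_adjoin z"
  by (induction I rule: infinite_finite_induct) (simp_all add: int_adjoin_add)

lemmas int_adjoin_intros = int_adjoin_add int_adjoin_mult int_adjoin_uminus int_adjoin_diff
  int_adjoin_power int_adjoin_sum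

section \<open>Integrality of the elements of Z[\<open>z\<close>]\<close>

lemma root_of_unity_power_mod:
  fixes z :: complex
  assumes "z ^ n = 1"
  shows "z ^ j = z ^ (j mod n)"
  using assms
  by (metis mod_div_mult_eq mult.commute mult_1 power_add power_mult power_one mult.right_neutral)

text \<open>Exponents are grouped by their residue modulo \<open>n\<close>. The powers of
  \<open>z\<close> may be linearly dependent, so the coefficients are not unique; only existence
  matters.\<close>

lemma int_adjoin_root_of_unity_span:
  assumes "z ^ n = 1" "n > 0" "x \<in> int_adjoin z"
  obtains c :: "nat \<Rightarrow> int" where "x = (\<Sum>i<n. of_int (c i) * z ^ i)"
proof -
  obtain f :: "int poly" where f: "x = poly (map_poly of_int f) z"
    using assms(3) by (auto simp: int_adjoin_def)
  note pow = root_of_unity_power_mod[OF assms(1)]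
  have "x = (\<Sum>j\<le>degree f. of_int (Polynomial.coeff f j) * z ^ j)"
    unfolding f by (simp add: poly_altdef)
  also have "\<dots> = (\<Sum>i<n. \<Sum>j\<in>{j \<in> {..degree f}. j mod n = i}. of_int (Polynomial.coeff f j) * z ^ j)"
    by (rule sum.group[symmetric]) (use assms(2) in auto)
  also have "\<dots> = (\<Sum>i<n. of_int (\<Sum>j\<in>{j \<in> {..degree f}. j mod n = i}. Polynomial.coeff f j) * z ^ i)"
  proof (rule sum.cong[OF refl])
    fix i
    show "(\<Sum>j\<in>{j \<in> {..degree f}. j mod n = i}. of_int (Polynomial.coeff f j) * z ^ j) =
      of_int (\<Sum>j\<in>{j \<in> {..degree f}. j mod n = i}. Polynomial.coeff f j) * z ^ i"
      unfolding of_int_sum sum_distrib_right by (rule sum.cong[OF refl]) (use pow in auto)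
  qed
  finally show ?thesis by (rule that)
qed

lemma algebraic_int_int_adjoin:
  assumes "z ^ n = 1" "n > 0" "x \<in> int_adjoin z"
  shows "algebraic_int x"
proof -
  obtain c :: "nat \<Rightarrow> int" where c: "x = (\<Sum>i<n. of_int (c i) * z ^ i)"
    using int_adjoin_root_of_unity_span[OF assms] .
  note pow = root_of_unity_power_mod[OF assms(1)]
  \<comment> \<open>Multiplication by \<open>x\<close> acts on the powers of \<open>z\<close> by an integral circulant matrix, so \<open>x\<close> is a
    root of its monic characteristic polynomial.\<close>
  define M :: "int mat" where "M = mat n n (\<lambda>(i, j). c ((j + (n - i)) mod n))"
  have M: "M \<in> carrier_mat n n" by (simp add: M_def)
  define v where "v = vec n (\<lambda>i. z ^ i)"
  \<comment> \<open>Entry \<open>(i, j)\<close> is the coefficient with index \<open>j - i\<close>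
    modulo \<open>n\<close>; adding \<open>n - i\<close> avoids truncated subtraction. Multiplying
    the expansion of \<open>x\<close> by \<open>z ^ i\<close> shifts exponents by \<open>i\<close>,
    which is the substitution \<open>j = (l + i) mod n\<close>.\<close>
  have row: "(\<Sum>j<n. of_int (c ((j + (n - i)) mod n)) * z ^ j) = x * z ^ i" if i: "i < n" for i
  proof -
    have "(\<Sum>j<n. of_int (c ((j + (n - i)) mod n)) * z ^ j) = (\<Sum>l<n. of_int (c l) * z ^ (l + i))"
    proof (rule sum.reindex_bij_witness[of _ "\<lambda>l. (l + i) mod n" "\<lambda>j. (j + (n - i)) mod n"])
      fix j assume "j \<in> {..<n}"
      then show "((j + (n - i)) mod n + i) mod n = j" using i by (simp add: mod_add_left_eq)
      show "(j + (n - i)) mod n \<in> {..<n}" using i by simp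
      show "of_int (c ((j + (n - i)) mod n)) * z ^ ((j + (n - i)) mod n + i)
        = of_int (c ((j + (n - i)) mod n)) * z ^ j"
        using pow[of "(j + (n - i)) mod n + i"] pow[of j] i by (simp add: mod_add_left_eq)
    next
      fix l assume "l \<in> {..<n}"
      then show "((l + i) mod n + (n - i)) mod n = l" using i by (subst mod_add_left_eq) simp
      show "(l + i) mod n \<in> {..<n}" using i by simp
    qed
    also have "\<dots> = x * z ^ i"
      unfolding c by (simp add: sum_distrib_right power_add mult.assoc)
    finally show ?thesis .
  qed
  have "eigenvector (map_mat of_int M) v x"
    unfolding eigenvector_def
  proof (intro conjI)
    show "v \<in> carrier_vec (dim_row (map_mat of_int M))" by (simp add: v_def M_def)
    show "v \<noteq> 0\<^sub>v (dim_row (map_mat of_int M))"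
    proof
      assume "v = 0\<^sub>v (dim_row (map_mat of_int M))"
      then have "v $ 0 = 0\<^sub>v n $ 0" by (simp add: M_def)
      then show False using assms(2) by (simp add: v_def)
    qed
    show "map_mat of_int M *\<^sub>v v = x \<cdot>\<^sub>v v"
    proof (rule eq_vecI)
      fix i assume "i < dim_vec (x \<cdot>\<^sub>v v)"
      then have i: "i < n" by (simp add: v_def)
      have "(map_mat of_int M *\<^sub>v v) $ i = (\<Sum>j<n. of_int (c ((j + (n - i)) mod n)) * z ^ j)"
        using i by (simp add: M_def v_def scalar_prod_def lessThan_atLeast0)
      then show "(map_mat of_int M *\<^sub>v v) $ i = (x \<cdot>\<^sub>v v) $ i"
        using i row[OF i] by (simp add: v_def)
    qed (simp add: v_def M_def)
  qed
  then have "eigenvalue (map_mat of_int M) x" by (auto simp: eigenvalue_def)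
  then have "poly (char_poly (map_mat of_int M)) x = 0"
    using eigenvalue_root_char_poly[of "map_mat of_int M" n x] M by auto
  then have "poly (map_poly of_int (char_poly M)) x = 0"
    by (simp add: of_int_hom.char_poly_hom[OF M])
  moreover have "lead_coeff (char_poly M) = 1"
    using degree_monic_char_poly[OF M] by auto
  ultimately show ?thesis unfolding algebraic_int_altdef_ipoly by blast
qed

text \<open>The quotient \<open>a / b\<close> is rational and an algebraic integer, hence an
  integer. This brings divisibility statements from Z[\<open>z\<close>] back to the
  integers.\<close>

lemma int_adjoin_divides_int:
  assumes "z ^ n = 1" "n > 0" "y \<in> int_adjoin z" "of_int a = of_int b * y" "b \<noteq> 0"
  shows "b dvd a"
proof -
  have y: "y = of_int a / of_int b" using assms(4,5) by simp
  have "y \<in> \<int>"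
    by (rule rational_algebraic_int_is_int[OF algebraic_int_int_adjoin[OF assms(1-3)]]) (simp add: y)
  then obtain d where "y = of_int d" by (auto elim: Ints_cases)
  then have "(of_int a :: complex) = of_int (b * d)" using assms(4) by simp
  then have "a = b * d" by (simp only: of_int_eq_iff)
  then show ?thesis by simp
qed

section \<open>Congruences in Z[\<open>z\<close>], for the moduli \<open>q\<close>, \<open>p\<close>
  and \<open>1 - z\<close>\<close>

definition adjoin_cong :: "complex \<Rightarrow> complex \<Rightarrow> complex \<Rightarrow> complex \<Rightarrow> bool" where
  "adjoin_cong z n x y \<longleftrightarrow> (\<exists>w\<in>int_adjoin z. x = y + n * w)"

lemma adjoin_cong_refl: "adjoin_cong z n x x"
  unfolding adjoin_cong_def by (rule bexI[of _ 0]) auto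

lemma adjoin_cong_sym: "adjoin_cong z n x y \<Longrightarrow> adjoin_cong z n y x"
  unfolding adjoin_cong_def by (auto intro!: bexI[of _ "- w" for w] int_adjoin_uminus)

lemma adjoin_cong_trans:
  assumes "adjoin_cong z n x y" "adjoin_cong z n y u"
  shows "adjoin_cong z n x u"
proof -
  obtain v w where "v \<in> int_adjoin z" "x = y + n * v" "w \<in> int_adjoin z" "y = u + n * w"
    using assms by (auto simp: adjoin_cong_def)
  then show ?thesis unfolding adjoin_cong_def
    by (intro bexI[of _ "v + w"]) (auto simp: algebra_simps intro: int_adjoin_add)
qed

lemma adjoin_cong_add:
  assumes "adjoin_cong z n x y" "adjoin_cong z n x' y'"
  shows "adjoin_cong z n (x + x') (y + y')"
proof -
  obtain v w where "v \<in> int_adjoin z" "x = y + n * v" "w \<in> int_adjoin z" "x' = y' + n * w"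
    using assms by (auto simp: adjoin_cong_def)
  then show ?thesis unfolding adjoin_cong_def
    by (intro bexI[of _ "v + w"]) (auto simp: algebra_simps intro: int_adjoin_add)
qed

text \<open>The identity \<open>x * x' - y * y' = (x - y) * x' + y * (x' - y')\<close> explains why
  membership is asked of \<open>y\<close> and \<open>x'\<close>.\<close>

lemma adjoin_cong_mult:
  assumes "adjoin_cong z n x y" "adjoin_cong z n x' y'" "y \<in> int_adjoin z" "x' \<in> int_adjoin z"
  shows "adjoin_cong z n (x * x') (y * y')"
proof -
  obtain v w where "v \<in> int_adjoin z" "x = y + n * v" "w \<in> int_adjoin z" "x' = y' + n * w"
    using assms by (auto simp: adjoin_cong_def)
  moreover from this have "v * x' + y * w \<in> int_adjoin z"
    using assms(3,4) by (intro int_adjoin_add int_adjoin_mult)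
  moreover have "x * x' = y * y' + n * (v * x' + y * w)"
    using \<open>x = y + n * v\<close> \<open>x' = y' + n * w\<close> by (simp add: algebra_simps)
  ultimately show ?thesis unfolding adjoin_cong_def by blast
qed

lemma adjoin_cong_power:
  assumes "adjoin_cong z n x y" "x \<in> int_adjoin z" "y \<in> int_adjoin z"
  shows "adjoin_cong z n (x ^ k) (y ^ k)"
  by (induction k) (auto intro: adjoin_cong_refl adjoin_cong_mult int_adjoin_power assms)

lemma adjoin_cong_sum:
  "(\<And>i. i \<in> I \<Longrightarrow> adjoin_cong z n (f i) (g i)) \<Longrightarrow> adjoin_cong z n (sum f I) (sum g I)"
  by (induction I rule: infinite_finite_induct) (auto intro: adjoin_cong_refl adjoin_cong_add)

section \<open>The Frobenius map modulo a prime\<close>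

lemma adjoin_cong_add_power_prime:
  fixes q :: nat
  assumes "Factorial_Ring.prime q" "x \<in> int_adjoin z" "y \<in> int_adjoin z"
  shows "adjoin_cong z (of_nat q) ((x + y) ^ q) (x ^ q + y ^ q)"
proof -
  have q: "q > 0" using assms(1) prime_gt_0_nat by blast
  have split: "{..q} = insert 0 (insert q {1..<q})" using q by auto
  have "(x + y) ^ q = (\<Sum>i\<le>q. of_nat (q choose i) * x ^ i * y ^ (q - i))"
    by (rule binomial_ring)
  also have "\<dots> = x ^ q + y ^ q + (\<Sum>i\<in>{1..<q}. of_nat (q choose i) * x ^ i * y ^ (q - i))"
    unfolding split using q by simp
  also have "(\<Sum>i\<in>{1..<q}. of_nat (q choose i) * x ^ i * y ^ (q - i)) =
      (\<Sum>i\<in>{1..<q}. of_nat q * (of_nat ((q choose i) div q) * x ^ i * y ^ (q - i)))"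
  proof (rule sum.cong[OF refl])
    fix i assume "i \<in> {1..<q}"
    then have "q dvd (q choose i)" by (intro dvd_choose_prime assms(1)) auto
    then have "(of_nat (q choose i) :: complex) = of_nat q * of_nat ((q choose i) div q)"
      by (metis dvd_mult_div_cancel of_nat_mult)
    then show "of_nat (q choose i) * x ^ i * y ^ (q - i) =
       of_nat q * (of_nat ((q choose i) div q) * x ^ i * y ^ (q - i))" by simp
  qed
  finally show ?thesis unfolding adjoin_cong_def
    by (intro bexI[of _ "\<Sum>i\<in>{1..<q}. of_nat ((q choose i) div q) * x ^ i * y ^ (q - i)"])
      (auto simp: sum_distrib_left intro!: int_adjoin_intros assms)
qed

lemma cong_power_prime_int:
  fixes q :: nat and a :: int
  assumes "Factorial_Ring.prime q"
  shows "[a ^ q = a] (mod int q)"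
proof (cases "int q dvd a")
  case True
  then have "int q dvd a ^ q" using assms by (metis dvd_power dvd_trans dvd_power_same dvd_refl prime_gt_0_nat)
  with True show ?thesis by (simp add: cong_iff_dvd_diff)
next
  case False
  have q: "q > 0" using assms prime_gt_0_nat by blast
  define b where "b = nat (a mod int q)"
  have b: "int b = a mod int q" using q by (simp add: b_def)
  have ab: "[a = int b] (mod int q)" by (simp add: b cong_def)
  have "\<not> q dvd b" using False b q by (metis dvd_mod_iff int_dvd_int_iff dvd_refl)
  then have "[b ^ (q - 1) = 1] (mod q)" by (rule fermat_theorem[OF assms])
  then have "[b * b ^ (q - 1) = b * 1] (mod q)" by (rule cong_scalar_left)
  then have "[b ^ q = b] (mod q)" using q by (simp add: power_eq_if)
  then have "[int b ^ q = int b] (mod int q)" by (simp flip: of_nat_power add: cong_int_iff)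
  moreover have "[a ^ q = int b ^ q] (mod int q)" using ab by (rule cong_pow)
  ultimately show ?thesis using ab by (metis cong_trans cong_sym)
qed

text \<open>Induction along the Horner form \<open>a + w * f(w)\<close>: modulo \<open>q\<close>,
  the \<open>q\<close>-th power is additive and fixes the integer \<open>a\<close>. The point
  \<open>w\<close> is arbitrary so that the congruence can be iterated at
  \<open>z ^ (q ^ t)\<close>.\<close>

lemma adjoin_cong_frobenius:
  fixes q :: nat and f :: "int poly"
  assumes "Factorial_Ring.prime q" "w \<in> int_adjoin z"
  shows "adjoin_cong z (of_nat q) (poly (map_poly of_int f) w ^ q) (poly (map_poly of_int f) (w ^ q))"
proof (induction f)
  case 0
  then show ?case using assms(1) prime_gt_0_nat[of q] by (simp add: power_0_left adjoin_cong_refl)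
next
  case (pCons a f)
  let ?F = "\<lambda>u. poly (map_poly of_int f) u :: complex"
  have F: "?F u \<in> int_adjoin z" if "u \<in> int_adjoin z" for u
    using that by (auto simp: poly_altdef intro!: int_adjoin_intros)
  have "[a ^ q = a] (mod int q)" by (rule cong_power_prime_int[OF assms(1)])
  then obtain d where "a ^ q = a + int q * d"
    by (metis cong_iff_lin cong_sym)
  then have "(of_int a :: complex) ^ q = of_int a + of_nat q * of_int d"
    by (metis of_int_add of_int_mult of_int_of_nat_eq of_int_power)
  then have a: "adjoin_cong z (of_nat q) (of_int a ^ q) (of_int a)"
    unfolding adjoin_cong_def by (intro bexI[of _ "of_int d"]) auto
  have "adjoin_cong z (of_nat q) ((of_int a + w * ?F w) ^ q) (of_int a ^ q + (w * ?F w) ^ q)"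
    by (rule adjoin_cong_add_power_prime[OF assms(1)]) (auto intro!: int_adjoin_mult F assms(2))
  moreover have "adjoin_cong z (of_nat q) ((w * ?F w) ^ q) (w ^ q * ?F (w ^ q))"
    unfolding power_mult_distrib
    by (rule adjoin_cong_mult) (auto intro: adjoin_cong_refl pCons.IH int_adjoin_power F assms(2))
  ultimately have "adjoin_cong z (of_nat q) ((of_int a + w * ?F w) ^ q) (of_int a + w ^ q * ?F (w ^ q))"
    using a adjoin_cong_add adjoin_cong_trans by blast
  then show ?case using pCons.hyps by (simp add: map_poly_pCons)
qed

lemma adjoin_cong_frobenius_iterate:
  fixes q :: nat and f :: "int poly"
  assumes "Factorial_Ring.prime q"
  shows "adjoin_cong z (of_nat q) (poly (map_poly of_int f) z ^ (q ^ t))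
    (poly (map_poly of_int f) (z ^ (q ^ t)))"
proof (induction t)
  case 0
  show ?case by (simp add: adjoin_cong_refl)
next
  case (Suc t)
  let ?F = "\<lambda>u. poly (map_poly of_int f) u :: complex"
  have F: "?F u \<in> int_adjoin z" if "u \<in> int_adjoin z" for u
    using that by (auto simp: poly_altdef intro!: int_adjoin_intros)
  have "adjoin_cong z (of_nat q) ((?F z ^ (q ^ t)) ^ q) (?F (z ^ (q ^ t)) ^ q)"
    by (rule adjoin_cong_power[OF Suc.IH]) (auto intro!: int_adjoin_power F)
  moreover have "adjoin_cong z (of_nat q) (?F (z ^ (q ^ t)) ^ q) (?F ((z ^ (q ^ t)) ^ q))"
    by (rule adjoin_cong_frobenius[OF assms]) (auto intro!: int_adjoin_power)
  ultimately show ?case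
    unfolding power_Suc2 power_mult by (rule adjoin_cong_trans)
qed

section \<open>Complex conjugation as a power of Frobenius\<close>

lemma cnj_root_of_unity:
  assumes "z ^ n = 1" "n > 0"
  shows "cnj z * z = 1"
proof -
  have "cmod z ^ n = 1" using assms(1) by (metis norm_one norm_power)
  then have "cmod z = 1" using assms(2) power_eq_imp_eq_base[of "cmod z" n 1] by simp
  then show ?thesis by (simp add: mult.commute complex_norm_square[symmetric])
qed

text \<open>A descent: if \<open>q\<close> divides \<open>n = x * cnj x\<close>, then
  \<open>q\<close> already divides \<open>x\<close> in Z[\<open>z\<close>]. Passing from
  \<open>x\<close> to \<open>x / q\<close> removes exactly two factors \<open>q\<close> from
  \<open>n\<close>.\<close>

lemma even_multiplicity_self_conjugate:
  fixes q n p t :: nat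
  assumes q: "Factorial_Ring.prime q" and z: "z ^ p = 1" and p: "p dvd q ^ t + 1" and t: "t > 0"
    and "x \<in> int_adjoin z" "x * cnj x = of_nat n" "n > 0"
  shows "even (multiplicity q n)"
  using assms(5-7)
proof (induction n arbitrary: x rule: less_induct)
  case (less n)
  have p0: "p > 0" using p by (metis dvd_0_left_iff gr0I add_is_0 one_neq_zero)
  have q1: "q > 1" using q prime_gt_1_nat by blast
  show ?case
  proof (cases "q dvd n")
    case False
    then show ?thesis by (simp add: not_dvd_imp_multiplicity_0)
  next
    case True
    obtain f :: "int poly" where f: "x = poly (map_poly of_int f) z"
      using less.prems by (auto simp: int_adjoin_def)
    let ?F = "\<lambda>u. poly (map_poly of_int f) u :: complex"
    have cnjF: "cnj (?F u) = ?F (cnj u)" for u by (simp add: poly_altdef)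
    have F: "?F u \<in> int_adjoin z" if "u \<in> int_adjoin z" for u
      using that by (auto simp: poly_altdef intro!: int_adjoin_intros)
    have "z ^ (q ^ t + 1) = 1" using z p by (metis dvdE power_mult power_one)
    then have zq: "z ^ (q ^ t) * z = 1" by (simp add: mult.commute)
    \<comment> \<open>Both sides are the inverse of \<open>z\<close>, since \<open>p\<close> divides
      \<open>q ^ t + 1\<close>.\<close>
    have cnjz: "cnj z = z ^ (q ^ t)"
      using zq cnj_root_of_unity[OF z p0] by (metis mult_right_cancel mult_zero_right zero_neq_one)
    have cx: "cnj x \<in> int_adjoin z" unfolding f cnjF cnjz by (intro F int_adjoin_power) simp
    have c1: "adjoin_cong z (of_nat q) (x ^ (q ^ t)) (cnj x)"
      unfolding f cnjF cnjz by (rule adjoin_cong_frobenius_iterate[OF q])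
    \<comment> \<open>Conjugating twice is the identity, so the \<open>2 * t\<close>-fold Frobenius
      map fixes \<open>x\<close> modulo \<open>q\<close>.\<close>
    have "z ^ (q ^ (t + t)) = z"
      by (metis cnjz complex_cnj_cnj complex_cnj_power power_add power_mult)
    then have c2: "adjoin_cong z (of_nat q) (x ^ (q ^ (t + t))) x"
      unfolding f using adjoin_cong_frobenius_iterate[OF q, of z f "t + t"] by simp
    have "adjoin_cong z (of_nat q) (x ^ (q ^ t) * x) (cnj x * x)"
      by (rule adjoin_cong_mult[OF c1 adjoin_cong_refl]) (use cx less.prems in auto)
    moreover have "adjoin_cong z (of_nat q) (cnj x * x) 0"
      unfolding adjoin_cong_def using True less.prems
      by (intro bexI[of _ "of_nat (n div q)"]) (auto simp: mult.commute of_nat_mult[symmetric])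
    ultimately have c3: "adjoin_cong z (of_nat q) (x ^ (q ^ t + 1)) 0"
      using adjoin_cong_trans by (simp add: mult.commute)
    \<comment> \<open>This inequality, which needs \<open>t > 0\<close>, makes
      \<open>x ^ (q ^ (t + t))\<close> a multiple of \<open>x ^ (q ^ t + 1)\<close>.\<close>
    have le: "q ^ t + 1 \<le> q ^ (t + t)"
    proof -
      have "q ^ t \<ge> 2" using t q1 by (metis Suc_leI Suc_1 one_less_power)
      then have "q ^ t * 2 \<le> q ^ t * q ^ t" by (intro mult_le_mono2)
      then show ?thesis using \<open>q ^ t \<ge> 2\<close> unfolding power_add by linarith
    qed
    \<comment> \<open>\<open>x\<close> is congruent to a power of itself that is divisible by \<open>x * cnj x\<close>.\<close>
    have c4: "adjoin_cong z (of_nat q) x 0"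
    proof -
      have "adjoin_cong z (of_nat q) (x ^ (q ^ t + 1) * x ^ (q ^ (t + t) - (q ^ t + 1)))
        (0 * x ^ (q ^ (t + t) - (q ^ t + 1)))"
        by (rule adjoin_cong_mult[OF c3 adjoin_cong_refl]) (auto intro!: int_adjoin_power less.prems)
      then have "adjoin_cong z (of_nat q) (x ^ (q ^ (t + t))) 0"
        using le by (simp only: power_add[symmetric] le_add_diff_inverse mult_zero_left)
      then show ?thesis using c2 adjoin_cong_sym adjoin_cong_trans by blast
    qed
    then obtain y where y: "y \<in> int_adjoin z" "x = of_nat q * y" by (auto simp: adjoin_cong_def)
    have cy: "cnj y \<in> int_adjoin z"
    proof -
      obtain g :: "int poly" where g: "y = poly (map_poly of_int g) z"
        using y by (auto simp: int_adjoin_def)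
      have "cnj y = poly (map_poly of_int g) (z ^ (q ^ t))"
        unfolding g cnjz[symmetric] by (simp add: poly_altdef)
      then show ?thesis by (auto simp: poly_altdef intro!: int_adjoin_intros)
    qed
    have eq: "of_nat n = of_nat (q\<^sup>2) * (y * cnj y)"
      using less.prems(2)[symmetric] unfolding y(2) by (simp add: power2_eq_square algebra_simps)
    \<comment> \<open>The quotient of \<open>n\<close> by the square of \<open>q\<close> is
      \<open>y * cnj y\<close>, an element of Z[\<open>z\<close>], hence an integer.\<close>
    have "int (q\<^sup>2) dvd int n"
      by (rule int_adjoin_divides_int[OF z p0, of "y * cnj y"])
        (use eq y cy q1 in \<open>auto intro: int_adjoin_mult\<close>)
    then have "q\<^sup>2 dvd n" by (simp only: int_dvd_int_iff)
    then obtain d where d: "n = q\<^sup>2 * d" by blast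
    have yd: "y * cnj y = of_nat d" using eq q1 unfolding d by simp
    have d0: "d > 0" using less.prems d by (auto intro: Nat.gr0I)
    have "1 * d < q\<^sup>2 * d" using d0 one_less_power[OF q1, of 2] by (intro mult_strict_right_mono) auto
    then have "d < n" unfolding d by simp
    then have "even (multiplicity q d)" using less.IH y(1) yd d0 by blast
    moreover have "multiplicity q n = multiplicity q (q\<^sup>2) + multiplicity q d"
      unfolding d using d0 q1 q by (intro prime_elem_multiplicity_mult_distrib) auto
    ultimately show ?thesis using q q1 by (simp add: multiplicity_same_power)
  qed
qed

section \<open>Reduction modulo \<open>1 - z\<close>\<close>

lemma adjoin_cong_one_minus_root_power: "adjoin_cong z (1 - z) (z ^ i) 1"
  unfolding adjoin_cong_def
  by (rule bexI[of _ "- (\<Sum>j<i. z ^ j)"])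
    (simp add: one_diff_power_eq[symmetric] , auto intro!: int_adjoin_intros)

lemma prime_dvd_if_one_minus_root_dvd:
  fixes p :: nat and a :: int
  assumes p: "Factorial_Ring.prime p" "odd p" and z: "z ^ p = 1"
    and a: "adjoin_cong z (1 - z) (of_int a) 0"
  shows "int p dvd a"
proof -
  have p0: "p > 0" using p(1) prime_gt_0_nat by blast
  \<comment> \<open>\<open>(1 - z) ^ p\<close> is congruent to \<open>1 - z ^ p = 0\<close> modulo \<open>p\<close>, so \<open>p\<close> divides \<open>a ^ p\<close>.\<close>
  obtain y where y: "y \<in> int_adjoin z" "of_int a = (1 - z) * y" using a by (auto simp: adjoin_cong_def)
  have "adjoin_cong z (of_nat p) ((1 + - z) ^ p) (1 ^ p + (- z) ^ p)"
    by (rule adjoin_cong_add_power_prime[OF p(1)]) (auto intro: int_adjoin_uminus)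
  \<comment> \<open>Oddness of \<open>p\<close> turns \<open>(- z) ^ p\<close> into
    \<open>- 1\<close>.\<close>
  moreover have "1 ^ p + (- z) ^ p = 0" using z p(2) by simp
  ultimately obtain w where w: "w \<in> int_adjoin z" "(1 - z) ^ p = of_nat p * w"
    by (auto simp: adjoin_cong_def)
  have "of_int (a ^ p) = of_int (int p) * (w * y ^ p)"
    using y(2) w(2) by (simp add: power_mult_distrib)
  then have "int p dvd a ^ p"
    using p0 w y by (intro int_adjoin_divides_int[OF z p0]) (auto intro!: int_adjoin_intros)
  then show ?thesis using p(1) by (metis prime_dvd_power prime_nat_int_transfer)
qed

section \<open>Characters of prime order\<close>

text \<open>The subgroup is the image of the \<open>p\<close>-th power map. Sylow's theorem with
  exponent 1 gives a subgroup of order \<open>p\<close>, hence a nontrivial kernel element; on a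
  finite group the map is then not surjective either.\<close>

lemma (in comm_group) proper_subgroup_powers:
  assumes "finite (carrier G)" "Factorial_Ring.prime p" "p dvd Coset.order G"
  obtains H where "subgroup H G" "H \<noteq> carrier G" "\<And>x. x \<in> carrier G \<Longrightarrow> x [^] p \<in> H"
proof -
  let ?f = "\<lambda>x. x [^] p"
  have hom: "group_hom G G ?f"
    by (simp add: group_hom_def group_hom_axioms_def is_group hom_def nat_pow_distrib pow_mult_distrib m_comm)
  obtain n where "Coset.order G = p ^ 1 * n" using assms(3) by auto
  then obtain K where K: "subgroup K G" "card K = p ^ 1"
    using sylow_thm[OF assms(2) is_group _ assms(1)] by blast
  have p1: "p > 1" using assms(2) prime_gt_1_nat by blast
  have "K \<noteq> {\<one>}" using K(2) p1 by auto
  then obtain x where x: "x \<in> K" "x \<noteq> \<one>" using subgroup.one_closed[OF K(1)] by blast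
  have xG: "x \<in> carrier G" using x(1) subgroup.subset[OF K(1)] by blast
  interpret GK: group "G\<lparr>carrier := K\<rparr>" using K(1) by (rule subgroup_imp_group)
  have "x [^]\<^bsub>G\<lparr>carrier := K\<rparr>\<^esub> Coset.order (G\<lparr>carrier := K\<rparr>) = \<one>\<^bsub>G\<lparr>carrier := K\<rparr>\<^esub>"
    by (rule GK.pow_order_eq_1) (use x in simp)
  then have xp: "?f x = \<one>"
    using K(2) by (simp add: Coset.order_def nat_pow_consistent[symmetric])
  show ?thesis
  proof (rule that[of "?f ` carrier G"])
    show "subgroup (?f ` carrier G) G" by (rule group_hom.img_is_subgroup[OF hom])
    show "?f ` carrier G \<noteq> carrier G"
    proof
      assume "?f ` carrier G = carrier G"
      then have "inj_on ?f (carrier G)" using assms(1) by (simp add: eq_card_imp_inj_on)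
      then show False using xp x(2) xG by (metis inj_onD nat_pow_one one_closed)
    qed
  qed auto
qed

text \<open>Take \<open>H\<close> maximal among the proper subgroups containing all
  \<open>p\<close>-th powers. Adjoining any \<open>g\<close> outside \<open>H\<close> gives a larger
  subgroup, which must be all of \<open>G\<close>. This \<open>H\<close> will lie in the kernel of
  the character.\<close>

lemma (in comm_group) maximal_subgroup_powers:
  assumes "finite (carrier G)" "Factorial_Ring.prime p" "p dvd Coset.order G"
  obtains H g where "subgroup H G" "g \<in> carrier G" "g \<notin> H"
    "\<And>x. x \<in> carrier G \<Longrightarrow> x [^] p \<in> H"
    "\<And>x. x \<in> carrier G \<Longrightarrow> \<exists>h\<in>H. \<exists>i :: nat. x = h \<otimes> g [^] i"
proof -
  define S where "S = {H. subgroup H G \<and> H \<noteq> carrier G \<and> (\<forall>x\<in>carrier G. x [^] p \<in> H)}"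
  have "S \<noteq> {}" unfolding S_def by (rule proper_subgroup_powers[OF assms]) blast
  moreover have "S \<subseteq> Pow (carrier G)" unfolding S_def using subgroup.subset by blast
  then have "finite S" using assms(1) finite_subset by blast
  ultimately have "\<exists>H\<in>S. \<forall>K\<in>S. H \<subseteq> K \<longrightarrow> H = K"
    by (intro finite_has_maximal)
  then obtain H where HS: "H \<in> S" and max: "\<And>K. K \<in> S \<Longrightarrow> H \<subseteq> K \<Longrightarrow> K = H"
    by blast
  from HS have H: "subgroup H G" "H \<noteq> carrier G" "\<And>x. x \<in> carrier G \<Longrightarrow> x [^] p \<in> H"
    by (auto simp: S_def)
  have HG: "subgroup H G" by (rule H(1))
  have "H \<subseteq> carrier G" by (rule subgroup.subset[OF HG])
  then obtain g where g: "g \<in> carrier G" "g \<notin> H" using H(2) by blast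
  let ?K = "H <#> generate G {g}"
  \<comment> \<open>Finiteness allows natural exponents only, matching the powers of
    \<open>z\<close> used later.\<close>
  have gK: "generate G {g} = {g [^] k | k. k \<in> (UNIV :: nat set)}"
    by (rule generate_pow_on_finite_carrier[OF assms(1) g(1)])
  have K: "subgroup ?K G"
    by (rule mult_subgroups[OF HG generate_is_subgroup]) (use g in auto)
  have HK: "h \<in> ?K" if "h \<in> H" for h
  proof -
    have "h = h \<otimes> g [^] (0::nat)" using that \<open>H \<subseteq> carrier G\<close> by auto
    then show ?thesis using that unfolding set_mult_def gK by blast
  qed
  have "g = \<one> \<otimes> g [^] (1::nat)" using g by simp
  then have "g \<in> ?K" using subgroup.one_closed[OF HG] unfolding set_mult_def gK by blast
  then have "?K \<noteq> H" using g by blast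
  moreover have "x [^] p \<in> ?K" if "x \<in> carrier G" for x using HK H(3) that by blast
  ultimately have "?K = carrier G" using max[of ?K] K HK unfolding S_def by blast
  then have "\<exists>h\<in>H. \<exists>i :: nat. x = h \<otimes> g [^] i" if "x \<in> carrier G" for x
    using that unfolding set_mult_def gK by blast
  then show ?thesis using that[OF HG g H(3)] by blast
qed

text \<open>The character sends \<open>h \<otimes> g [^] i\<close> to \<open>z ^ i\<close>. It is
  well defined because \<open>g [^] d\<close> lies in \<open>H\<close> only when \<open>p\<close>
  divides \<open>d\<close>.\<close>

lemma (in comm_group) exists_character_prime_order:
  fixes z :: complex
  assumes "finite (carrier G)" "Factorial_Ring.prime p" "p dvd Coset.order G"
    and z: "z ^ p = 1"
  obtains \<chi> g where "g \<in> carrier G" "\<chi> g = z"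
    "\<And>x y. x \<in> carrier G \<Longrightarrow> y \<in> carrier G \<Longrightarrow> \<chi> (x \<otimes> y) = \<chi> x * \<chi> y"
    "\<And>x. x \<in> carrier G \<Longrightarrow> \<exists>i. \<chi> x = z ^ i"
proof -
  obtain H g where H: "subgroup H G" and g: "g \<in> carrier G" "g \<notin> H"
    and pow: "\<And>x. x \<in> carrier G \<Longrightarrow> x [^] p \<in> H"
    and ex: "\<And>x. x \<in> carrier G \<Longrightarrow> \<exists>h\<in>H. \<exists>i :: nat. x = h \<otimes> g [^] i"
    by (rule maximal_subgroup_powers[OF assms(1-3)]) blast
  have HG: "h \<in> carrier G" if "h \<in> H" for h using that subgroup.subset[OF H] by blast
  have p0: "p > 0" using assms(2) prime_gt_0_nat by blast
  have Hpow: "h [^] n \<in> H" if "h \<in> H" for h and n :: nat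
    using that by (induction n) (simp_all add: subgroup.m_closed[OF H] subgroup.one_closed[OF H])
  \<comment> \<open>Otherwise Bezout's identity for \<open>d\<close> and \<open>p\<close> expresses
    \<open>g\<close> through powers of \<open>g [^] d\<close> and \<open>g [^] p\<close>, both in
    \<open>H\<close>.\<close>
  have dvd: "p dvd d" if d: "g [^] d \<in> H" for d :: nat
  proof (rule ccontr)
    assume "\<not> p dvd d"
    then have "coprime d p" using assms(2) by (metis coprime_commute prime_imp_coprime)
    then obtain u where u: "[d * u = 1] (mod p)" using cong_solve_coprime_nat by fastforce
    then obtain s t where st: "1 + s * p = d * u + t * p"
      unfolding cong_iff_lin_nat by metis
    have "(g [^] d) [^] u \<otimes> (g [^] p) [^] t = g [^] (d * u + t * p)"
      using g by (simp add: nat_pow_pow nat_pow_mult mult.commute)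
    also have "\<dots> = g [^] (1 + s * p)" by (simp only: st)
    also have "\<dots> = g \<otimes> (g [^] p) [^] s"
      using g by (simp add: nat_pow_pow mult.commute m_comm)
    finally have "(g [^] d) [^] u \<otimes> (g [^] p) [^] t = g \<otimes> (g [^] p) [^] s" .
    moreover have "(g [^] d) [^] u \<otimes> (g [^] p) [^] t \<in> H"
      by (intro subgroup.m_closed[OF H] Hpow[OF d] Hpow[OF pow[OF g(1)]])
    moreover have "(g [^] p) [^] s \<in> H"
      using pow[OF g(1)] by (rule Hpow)
    ultimately have "g \<in> H"
      using g HG H by (metis inv_solve_right subgroup.m_closed subgroup.m_inv_closed m_closed)
    then show False using g by simp
  qed
  have wd: "z ^ i = z ^ j" if eq: "h \<otimes> g [^] i = h' \<otimes> g [^] j" and h: "h \<in> H" "h' \<in> H" and le: "i \<le> j"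
    for h h' and i j :: nat
  proof -
    have "g [^] j = g [^] (j - i) \<otimes> g [^] i" using le g by (simp add: nat_pow_mult)
    then have "h \<otimes> g [^] i = (h' \<otimes> g [^] (j - i)) \<otimes> g [^] i"
      using eq h g HG by (simp add: m_assoc)
    then have "h = h' \<otimes> g [^] (j - i)"
      using h g HG by (subst (asm) right_cancel) auto
    then have "g [^] (j - i) = inv h' \<otimes> h"
      using h g HG by (metis inv_solve_left nat_pow_closed)
    then have "p dvd j - i"
      using h H by (intro dvd) (simp add: subgroup.m_closed subgroup.m_inv_closed)
    then have "z ^ (j - i) = 1" using z by (metis dvdE power_mult power_one)
    then show ?thesis using le by (metis le_add_diff_inverse mult.right_neutral power_add)
  qed
  \<comment> \<open>The choice picks an arbitrary exponent representing \<open>x\<close>; by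
    \<open>wd\<close> every other one gives the same power of \<open>z\<close>.\<close>
  define \<chi> where "\<chi> x = z ^ (SOME i. \<exists>h\<in>H. x = h \<otimes> g [^] i)" for x
  have \<chi>: "\<chi> (h \<otimes> g [^] i) = z ^ i" if h: "h \<in> H" for h and i :: nat
  proof -
    define j where "j = (SOME j :: nat. \<exists>h'\<in>H. h \<otimes> g [^] i = h' \<otimes> g [^] j)"
    have "\<exists>h'\<in>H. h \<otimes> g [^] i = h' \<otimes> g [^] j"
      unfolding j_def
      by (rule someI[of _ i]) (rule bexI[OF refl h])
    then obtain h' where h': "h' \<in> H" "h \<otimes> g [^] i = h' \<otimes> g [^] j" by blast
    have "z ^ i = z ^ j"
    proof (cases "i \<le> j")
      case True
      then show ?thesis by (rule wd[OF h'(2) h h'(1)])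
    next
      case False
      then show ?thesis by (intro wd[OF h'(2)[symmetric] h'(1) h, symmetric]) simp
    qed
    then show ?thesis by (simp add: \<chi>_def j_def)
  qed
  show ?thesis
  proof (rule that[of g \<chi>])
    show "g \<in> carrier G" by (rule g(1))
    show "\<chi> g = z"
      using \<chi>[of \<one> 1] g subgroup.one_closed[OF H] by simp
  next
    fix x y assume xy: "x \<in> carrier G" "y \<in> carrier G"
    obtain h h' and i j :: nat where hh: "h \<in> H" "h' \<in> H" "x = h \<otimes> g [^] i" "y = h' \<otimes> g [^] j"
      using ex xy by metis
    have "x \<otimes> y = (h \<otimes> h') \<otimes> g [^] (i + j)"
      using hh g HG by (simp add: nat_pow_mult[symmetric] m_ac)
    then show "\<chi> (x \<otimes> y) = \<chi> x * \<chi> y"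
      using \<chi> hh H by (simp add: subgroup.m_closed power_add)
  next
    fix x assume "x \<in> carrier G"
    then show "\<exists>i. \<chi> x = z ^ i" using ex \<chi> by metis
  qed
qed

lemma (in group) sum_character_eq_0:
  fixes \<chi> :: "'a \<Rightarrow> complex"
  assumes hom: "\<And>x y. x \<in> carrier G \<Longrightarrow> y \<in> carrier G \<Longrightarrow> \<chi> (x \<otimes> y) = \<chi> x * \<chi> y"
    and g: "g \<in> carrier G" "\<chi> g \<noteq> 1"
  shows "(\<Sum>x\<in>carrier G. \<chi> x) = 0"
proof -
  have "(\<Sum>x\<in>carrier G. \<chi> x) = (\<Sum>x\<in>carrier G. \<chi> (g \<otimes> x))"
    by (rule sum.reindex_bij_witness[of _ "\<lambda>x. g \<otimes> x" "\<lambda>x. inv g \<otimes> x"])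
      (use g in \<open>auto simp: m_assoc[symmetric]\<close>)
  also have "\<dots> = \<chi> g * (\<Sum>x\<in>carrier G. \<chi> x)"
    using hom g by (simp add: sum_distrib_left)
  finally show ?thesis using g(2) by simp
qed

section \<open>Character sums of an SEDF\<close>

text \<open>The multiset condition is turned into an identity for an arbitrary weight
  \<open>f\<close>: the constant 1 yields the parameter equation, a character yields the equation
  for character sums.\<close>

lemma sum_ext_quotients:
  fixes G (structure) and f :: "'a \<Rightarrow> complex"
  assumes D: "is_SEDF G v m k lam D" and j: "j \<in> {1..m}"
  shows "(\<Sum>l\<in>{1..m} - {j}. \<Sum>x\<in>D l. \<Sum>y\<in>D j. f (x \<otimes>\<^bsub>G\<^esub> inv\<^bsub>G\<^esub> y))
    = of_nat lam * (\<Sum>g\<in>carrier G - {\<one>\<^bsub>G\<^esub>}. f g)"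
proof -
  let ?T = "SIGMA l : {1..m} - {j}. D l \<times> D j"
  let ?h = "\<lambda>(l :: nat, x, y). x \<otimes>\<^bsub>G\<^esub> inv\<^bsub>G\<^esub> y"
  interpret comm_group G using D by (simp add: is_SEDF_def)
  have fin: "finite (carrier G)" using D by (simp add: is_SEDF_def)
  have sub: "D l \<subseteq> carrier G" if "l \<in> {1..m}" for l using D that by (simp add: is_SEDF_def)
  have finD: "finite (D l)" if "l \<in> {1..m}" for l using finite_subset[OF sub[OF that] fin] .
  have finT: "finite ?T" using finD j by auto
  \<comment> \<open>Multiplicities become sizes of fibres of \<open>?h\<close>, so the sum over
    triples can be regrouped by the value of the quotient.\<close>
  have cnt: "count (ext_quotients G m D j) g = card {t \<in> ?T. ?h t = g}" for g
    unfolding ext_quotients_def count_image_mset using finT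
    by (simp add: sum.If_cases card_eq_sum[symmetric] vimage_def Int_def conj_commute)
  have lam: "card {t \<in> ?T. ?h t = g} = lam" if "g \<in> carrier G - {\<one>}" for g
    using D j that unfolding is_SEDF_def cnt[symmetric] by blast
  have "count (ext_quotients G m D j) \<one> = 0"
    using D j unfolding is_SEDF_def by (simp add: count_eq_zero_iff)
  then have empty: "{t \<in> ?T. ?h t = \<one>} = {}"
    using finT unfolding cnt by (simp add: card_eq_0_iff)
  have im: "?h ` ?T \<subseteq> carrier G - {\<one>}" 
  proof (rule image_subsetI)
    fix t assume t: "t \<in> ?T"
    then have "?h t \<noteq> \<one>" using empty by blast
    moreover obtain l x y where "t = (l, x, y)" by (cases t)
    then have "?h t \<in> carrier G" using t sub[of l] sub[of j] j by auto
    ultimately show "?h t \<in> carrier G - {\<one>}" by blast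
  qed
  have "(\<Sum>l\<in>{1..m} - {j}. \<Sum>x\<in>D l. \<Sum>y\<in>D j. f (x \<otimes> inv y)) = (\<Sum>t\<in>?T. f (?h t))"
    using finD j by (simp add: sum.Sigma split_def)
  also have "\<dots> = (\<Sum>g\<in>carrier G - {\<one>}. \<Sum>t\<in>{t \<in> ?T. ?h t = g}. f (?h t))"
    by (rule sum.group[symmetric]) (use finT fin im in auto)
  also have "\<dots> = (\<Sum>g\<in>carrier G - {\<one>}. of_nat lam * f g)"
  proof (rule sum.cong[OF refl])
    fix g assume g: "g \<in> carrier G - {\<one>}"
    have "(\<Sum>t\<in>{t \<in> ?T. ?h t = g}. f (?h t)) = (\<Sum>t\<in>{t \<in> ?T. ?h t = g}. f g)"
      by (rule sum.cong) auto
    then show "(\<Sum>t\<in>{t \<in> ?T. ?h t = g}. f (?h t)) = of_nat lam * f g"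
      using lam[OF g] by simp
  qed
  finally show ?thesis by (simp add: sum_distrib_left)
qed

text \<open>Count the external quotients for \<open>j = 1\<close> in two ways, by triples and by
  values.\<close>

lemma SEDF_parameters:
  fixes G (structure)
  assumes D: "is_SEDF G v m k lam D" and m: "m > 0" and v: "v > 0"
  shows "(m - 1) * k\<^sup>2 = lam * (v - 1)"
proof -
  interpret comm_group G using D by (simp add: is_SEDF_def)
  have card: "card (D l) = k" if "l \<in> {1..m}" for l using D that by (simp add: is_SEDF_def)
  have "card (carrier G - {\<one>}) = v - 1"
    using D by (simp add: is_SEDF_def Coset.order_def)
  moreover have "(\<Sum>l\<in>{1..m} - {1}. \<Sum>x\<in>D l. \<Sum>y\<in>D 1. (1::complex)) =
      (\<Sum>l\<in>{1..m} - {1}. of_nat k * of_nat k)"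
    using card m by (intro sum.cong) auto
  moreover have "card ({1..m} - {1}) = m - 1" using m by simp
  ultimately have "of_nat ((m - 1) * k\<^sup>2) = (of_nat (lam * (v - 1)) :: complex)"
    using sum_ext_quotients[OF D, of 1 "\<lambda>_. 1"] m
    by (simp add: power2_eq_square)
  then show ?thesis by (simp only: of_nat_eq_iff)
qed

text \<open>The ratios \<open>a j / A\<close> take two values \<open>u > 1\<close> and
  \<open>1 - u\<close>. If \<open>u\<close> occurs \<open>s\<close> times, the sum
  \<open>s * u + (m - s) * (1 - u) = 1\<close> rearranges to
  \<open>u * (s - 1) = (1 - u) * (s + 1 - m)\<close>. Multiplying by \<open>A\<close> gives a
  relation free of division, ready for reduction modulo \<open>1 - z\<close>.\<close>

lemma two_valued_character_sums:
  fixes a :: "nat \<Rightarrow> complex" and L :: real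
  assumes m: "m > 0" and L: "L > 0" and A: "A = (\<Sum>l\<in>{1..m}. a l)" "A \<noteq> 0"
    and eq: "\<And>j. j \<in> {1..m} \<Longrightarrow> (A - a j) * cnj (a j) = - of_real L"
  obtains i j s where "i \<in> {1..m}" "j \<in> {1..m}"
    "a i * of_int (int s - 1) = a j * of_int (int s + 1 - int m)"
proof -
  define N where "N = (cmod A)\<^sup>2"
  have N: "N > 0" using A(2) by (simp add: N_def)
  \<comment> \<open>This is \<open>a j / A\<close>: by hypothesis \<open>A * cnj (a j)\<close> is
    the real number in the numerator, and \<open>A * cnj A = N\<close>.\<close>
  define r where "r j = ((cmod (a j))\<^sup>2 - L) / N" for j
  have ar: "a j = of_real (r j) * A" if j: "j \<in> {1..m}" for j
  proof -
    have "A * cnj (a j) = of_real ((cmod (a j))\<^sup>2 - L)"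
      using eq[OF j] complex_norm_square[of "a j"] by (simp add: algebra_simps)
    then have "cnj (A * cnj (a j)) = of_real ((cmod (a j))\<^sup>2 - L)"
      by (simp only: complex_cnj_complex_of_real)
    then have "a j * (A * cnj A) = of_real ((cmod (a j))\<^sup>2 - L) * A" by (simp add: mult_ac)
    then show ?thesis
      using N complex_norm_square[of A] by (simp add: r_def N_def field_simps)
  qed
  have rr: "r j * (r j - 1) = L / N" if j: "j \<in> {1..m}" for j
  proof -
    have "(cmod (a j))\<^sup>2 = (r j)\<^sup>2 * N"
      by (subst ar[OF j]) (simp add: norm_mult power_mult_distrib N_def)
    moreover have "(cmod (a j))\<^sup>2 = r j * N + L" using N by (simp add: r_def)
    ultimately show ?thesis using N by (simp add: field_simps power2_eq_square)
  qed
  have "A * 1 = A * of_real (\<Sum>l\<in>{1..m}. r l)"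
    using A(1) by (simp add: sum_distrib_left ar mult.commute)
  then have sum1: "(\<Sum>l\<in>{1..m}. r l) = 1" using A(2) by (metis mult_left_cancel of_real_eq_1_iff)
  have LN: "L / N > 0" using L N by simp
  have sign: "r j < 0 \<or> r j > 1" if j: "j \<in> {1..m}" for j
    using rr[OF j] LN by (metis diff_gt_0_iff_gt zero_less_mult_iff diff_less_0_iff_less)
  \<comment> \<open>If all ratios exceeded 1, so would their sum; if all were negative, the sum
    could not be 1. Hence both kinds occur.\<close>
  have "\<exists>j\<in>{1..m}. r j < 0"
  proof (rule ccontr)
    assume "\<not> ?thesis"
    then have gt: "r j > 1" if "j \<in> {1..m}" for j using sign that by blast
    have "r 1 \<le> (\<Sum>l\<in>{1..m}. r l)" using m gt by (intro member_le_sum) force+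
    then show False using gt[of 1] m sum1 by simp
  qed
  then obtain j where j: "j \<in> {1..m}" "r j < 0" by blast
  have "\<exists>i\<in>{1..m}. r i > 1"
  proof (rule ccontr)
    assume "\<not> ?thesis"
    then have "(\<Sum>l\<in>{1..m}. r l) \<le> 0" using sign by (intro sum_nonpos) force
    then show False using sum1 by simp
  qed
  then obtain i where i: "i \<in> {1..m}" "r i > 1" by blast
  \<comment> \<open>\<open>r i\<close> and \<open>1 - r i\<close> are the two roots of the common
    quadratic equation.\<close>
  have two: "r l = r i \<or> r l = 1 - r i" if l: "l \<in> {1..m}" for l
  proof -
    have "(r l - r i) * (r l - (1 - r i)) = 0"
      using rr[OF l] rr[OF i(1)] by (simp add: algebra_simps)
    then show ?thesis by simp
  qed
  define S where "S = {l \<in> {1..m}. r l > 1}"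
  have S: "S \<subseteq> {1..m}" "finite S" by (auto simp: S_def)
  have cS: "card ({1..m} - S) = m - card S" "card S \<le> m"
    using S card_Diff_subset[of S "{1..m}"] card_mono[of "{1..m}" S] by auto
  have "(\<Sum>l\<in>{1..m}. r l) = (\<Sum>l\<in>{1..m} - S. r l) + (\<Sum>l\<in>S. r l)"
    using S by (intro sum.subset_diff) auto
  moreover have "(\<Sum>l\<in>S. r l) = (\<Sum>l\<in>S. r i)"
  proof (rule sum.cong[OF refl])
    fix l assume "l \<in> S"
    then show "r l = r i" using two[of l] i by (auto simp: S_def)
  qed
  moreover have "(\<Sum>l\<in>{1..m} - S. r l) = (\<Sum>l\<in>{1..m} - S. 1 - r i)"
  proof (rule sum.cong[OF refl])
    fix l assume "l \<in> {1..m} - S"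
    then show "r l = 1 - r i" using two[of l] i by (auto simp: S_def)
  qed
  ultimately have key: "(real m - real (card S)) * (1 - r i) + real (card S) * r i = 1"
    using sum1 cS by (simp add: of_nat_diff)
  have rj: "r j = 1 - r i" using two[OF j(1)] i j by auto
  have "r i * (real (card S) - 1) = r j * (real (card S) + 1 - real m)"
    unfolding rj using key by (simp add: algebra_simps)
  then have "(of_real (r i * (real (card S) - 1)) :: complex) = of_real (r j * (real (card S) + 1 - real m))"
    by simp
  then have "a i * of_int (int (card S) - 1) = a j * of_int (int (card S) + 1 - int m)"
    by (simp add: ar[OF i(1)] ar[OF j(1)] mult_ac)
  then show ?thesis using that i(1) j(1) by blast
qed

text \<open>Both parts of the theorem are instances: only the parity of \<open>t\<close> plus the
  multiplicity of \<open>q\<close> in \<open>m - 1\<close> matters.\<close>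

lemma no_SEDF:
  fixes G (structure) and p q t m k lam :: nat
  assumes D: "is_SEDF G (q ^ t + 1) m k lam D" and m: "m > 2"
    and p: "Factorial_Ring.prime p" "odd p" and q: "Factorial_Ring.prime q"
    and t: "t > 0" and pq: "p dvd q ^ t + 1"
    and odd: "odd (multiplicity q (m - 1) + t)" and ndvd: "\<not> p dvd (m - 2) * k"
  shows False
proof -
  interpret comm_group G using D by (simp add: is_SEDF_def)
  have fin: "finite (carrier G)" and ord: "Coset.order G = q ^ t + 1" using D by (auto simp: is_SEDF_def)
  have sub: "D l \<subseteq> carrier G" if "l \<in> {1..m}" for l using D that by (simp add: is_SEDF_def)
  have card: "card (D l) = k" if "l \<in> {1..m}" for l using D that by (simp add: is_SEDF_def)
  have p1: "p > 1" using p(1) prime_gt_1_nat by blast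
  have q1: "q > 1" using q prime_gt_1_nat by blast
  have k: "k > 0" using ndvd by (cases k) auto
  have par: "(m - 1) * k\<^sup>2 = lam * q ^ t" using SEDF_parameters[OF D] m by simp
  have lam: "lam > 0" using par m k by (cases lam) auto
  \<comment> \<open>Compare the multiplicities of \<open>q\<close> on both sides of
    \<open>par\<close>; the square contributes an even amount.\<close>
  have odd_lam: "odd (multiplicity q lam)"
  proof -
    have pe: "prime_elem q" using q by simp
    have "multiplicity q ((m - 1) * k\<^sup>2) = multiplicity q (m - 1) + 2 * multiplicity q k"
      using m k pe by (simp add: prime_elem_multiplicity_mult_distrib prime_elem_multiplicity_power_distrib)
    moreover have "multiplicity q (lam * q ^ t) = multiplicity q lam + t"
      using lam q1 pe by (simp add: prime_elem_multiplicity_mult_distrib multiplicity_same_power)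
    ultimately have "multiplicity q (m - 1) + 2 * multiplicity q k = multiplicity q lam + t"
      using par by simp
    then show ?thesis using odd by presburger
  qed
  have "card {z :: complex. z ^ p = 1} = p" using p1 by (intro card_roots_unity_eq) simp
  then have "{z :: complex. z ^ p = 1} \<noteq> {1}" using p1 by (metis card.empty card_insert_disjoint finite.emptyI empty_iff nat_neq_iff One_nat_def)
  then obtain z :: complex where z: "z ^ p = 1" "z \<noteq> 1" by auto
  obtain \<chi> g where g: "g \<in> carrier G" "\<chi> g = z"
    and hom: "\<And>x y. x \<in> carrier G \<Longrightarrow> y \<in> carrier G \<Longrightarrow> \<chi> (x \<otimes> y) = \<chi> x * \<chi> y"
    and img: "\<And>x. x \<in> carrier G \<Longrightarrow> \<exists>i. \<chi> x = z ^ i"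
    by (rule exists_character_prime_order[OF fin p(1) _ z(1)]) (use pq ord in auto)
  have z0: "z \<noteq> 0" using z(1) p1 by (auto simp: power_0_left)
  have one: "\<chi> \<one> = 1" using hom[of \<one> \<one>] img[of \<one>] z0 by auto
  have inv: "\<chi> (inv y) = cnj (\<chi> y)" if y: "y \<in> carrier G" for y
  proof -
    obtain i where i: "\<chi> y = z ^ i" using img y by blast
    have "(\<chi> y) ^ p = 1" unfolding i using z(1) by (metis mult.commute power_mult power_one)
    then have "cnj (\<chi> y) * \<chi> y = 1" using p1 by (intro cnj_root_of_unity) auto
    moreover have "\<chi> (inv y) * \<chi> y = 1" using hom[of "inv y" y] one y by simp
    moreover have "\<chi> y \<noteq> 0" using i z0 by simp
    ultimately show ?thesis by (metis mult_right_cancel)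
  qed
  define a where "a l = (\<Sum>x\<in>D l. \<chi> x)" for l
  define A where "A = (\<Sum>l\<in>{1..m}. a l)"
  have aR: "a l \<in> int_adjoin z" if "l \<in> {1..m}" for l
    unfolding a_def using img sub[OF that] by (intro int_adjoin_sum) (metis int_adjoin_power int_adjoin_self subsetD)
  \<comment> \<open>Every character value is a power of \<open>z\<close>, hence congruent to 1, and
    \<open>D l\<close> has \<open>k\<close> elements.\<close>
  have ak: "adjoin_cong z (1 - z) (a l) (of_nat k)" if l: "l \<in> {1..m}" for l
  proof -
    have "adjoin_cong z (1 - z) (a l) (\<Sum>x\<in>D l. 1)"
      unfolding a_def using img sub[OF l] by (intro adjoin_cong_sum) (metis adjoin_cong_one_minus_root_power subsetD)
    then show ?thesis using card[OF l] by simp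
  qed
  \<comment> \<open>Expanding the product gives the sum of \<open>\<chi>\<close> over all external
    quotients for \<open>j\<close>, which is \<open>lam\<close> times the sum over the nonidentity
    elements. The latter is \<open>- 1\<close>, as the sum of \<open>\<chi>\<close> over the whole
    group vanishes.\<close>
  have eq: "(A - a j) * cnj (a j) = - of_nat lam" if j: "j \<in> {1..m}" for j
  proof -
    have "A - a j = (\<Sum>l\<in>{1..m} - {j}. a l)" unfolding A_def using j by (simp add: sum_diff1)
    then have "(A - a j) * cnj (a j) = (\<Sum>l\<in>{1..m} - {j}. a l * cnj (a j))"
      by (simp only: sum_distrib_right)
    also have "\<dots> = (\<Sum>l\<in>{1..m} - {j}. \<Sum>x\<in>D l. \<Sum>y\<in>D j. \<chi> x * cnj (\<chi> y))"
      by (simp only: a_def cnj_sum sum_product)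
    also have "\<dots> = (\<Sum>l\<in>{1..m} - {j}. \<Sum>x\<in>D l. \<Sum>y\<in>D j. \<chi> (x \<otimes> inv y))"
    proof (intro sum.cong refl)
      fix l x y assume "l \<in> {1..m} - {j}" "x \<in> D l" "y \<in> D j"
      then have "x \<in> carrier G" "y \<in> carrier G" using sub j by blast+
      then show "\<chi> x * cnj (\<chi> y) = \<chi> (x \<otimes> inv y)" using hom inv by simp
    qed
    also have "\<dots> = of_nat lam * (\<Sum>x\<in>carrier G - {\<one>}. \<chi> x)" by (rule sum_ext_quotients[OF D j])
    also have "(\<Sum>x\<in>carrier G - {\<one>}. \<chi> x) = - 1"
      using sum_character_eq_0[of \<chi> g] hom g z(2) fin one by (simp add: sum_diff1)
    finally show ?thesis by simp
  qed
  show False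
  proof (cases "A = 0")
    case True
    have "a 1 * cnj (a 1) = of_nat lam" using eq[of 1] m True by simp
    moreover have "a 1 \<in> int_adjoin z" using aR m by simp
    ultimately have "even (multiplicity q lam)"
      using even_multiplicity_self_conjugate[OF q z(1) pq t] lam by blast
    then show False using odd_lam by simp
  next
    case False
    obtain i j s where ij: "i \<in> {1..m}" "j \<in> {1..m}"
      and s: "a i * of_int (int s - 1) = a j * of_int (int s + 1 - int m)"
    proof (rule two_valued_character_sums[of m "real lam" A a])
      show "(A - a j) * cnj (a j) = - of_real (real lam)" if "j \<in> {1..m}" for j using eq[OF that] by simp
    qed (use m lam A_def False in auto)
    have cong: "adjoin_cong z (1 - z) (a l * of_int b) (of_int (int k * b))" if "l \<in> {1..m}" for l b
      using adjoin_cong_mult[OF ak[OF that] adjoin_cong_refl, of "of_int b"] by simp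
    \<comment> \<open>Replacing \<open>a i\<close> and \<open>a j\<close> by \<open>k\<close> leaves
      two multiples of \<open>k\<close> whose factors differ by \<open>m - 2\<close>; the unknown
      \<open>s\<close> cancels.\<close>
    have "adjoin_cong z (1 - z) (of_int (int k * (int s - 1))) (of_int (int k * (int s + 1 - int m)))"
      using adjoin_cong_trans[OF adjoin_cong_sym[OF cong[OF ij(1), of "int s - 1"]]]
        cong[OF ij(2), of "int s + 1 - int m"] unfolding s by blast
    then have "adjoin_cong z (1 - z) (of_int (int k * (int m - 2))) 0"
      unfolding adjoin_cong_def by (auto simp: algebra_simps)
    then have "int p dvd int k * (int m - 2)"
      by (rule prime_dvd_if_one_minus_root_dvd[OF p z(1)])
    moreover have "int k * (int m - 2) = int ((m - 2) * k)" using m by (simp add: of_nat_diff)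
    ultimately show False using ndvd by (simp only: int_dvd_int_iff)
  qed
qed

section \<open>Specialisation to the two families of group orders\<close>

lemma exact_power_dvd_multiplicity: "exact_power_dvd q a n \<Longrightarrow> multiplicity q n = a"
  unfolding exact_power_dvd_def by (intro multiplicity_eqI) auto

theorem theorem4p6:
  fixes m b c k lam :: nat
  assumes "m > 2" and "b > 0" and "c > 0"
  shows "(\<forall>p q :: nat.
            Factorial_Ring.prime p \<and> p > 2 \<and> Factorial_Ring.prime q \<and> p \<noteq> q \<and>
            p dvd q ^ (2 * b) + 1 \<and>
            exact_power_dvd q (2 * c + 1) (m - 1) \<and>
            \<not> p dvd (m - 2) * k \<longrightarrow>
            \<not> (\<exists>(G :: ('a, 'b) monoid_scheme) D. is_SEDF G (q ^ (2 * b) + 1) m k lam D)) \<and>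
         (\<forall>p q :: nat.
            Factorial_Ring.prime q \<and>
            (exact_power_dvd q (2 * c) (m - 1) \<or> \<not> q dvd m - 1) \<and>
            Factorial_Ring.prime p \<and> odd p \<and>
            p dvd q ^ (2 * b + 1) + 1 \<and>
            \<not> p dvd (m - 2) * k \<longrightarrow>
            \<not> (\<exists>(G :: ('a, 'b) monoid_scheme) D. is_SEDF G (q ^ (2 * b + 1) + 1) m k lam D))"
proof (intro conjI allI impI notI; elim conjE exE)
  fix p q :: nat and G :: "('a, 'b) monoid_scheme" and D
  assume "Factorial_Ring.prime p" "p > 2" "Factorial_Ring.prime q" "p dvd q ^ (2 * b) + 1"
    "exact_power_dvd q (2 * c + 1) (m - 1)" "\<not> p dvd (m - 2) * k"
    "is_SEDF G (q ^ (2 * b) + 1) m k lam D"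
  \<comment> \<open>Here the multiplicity \<open>2 * c + 1\<close> is odd and
    \<open>t = 2 * b\<close> is even.\<close>
  then show False
    using assms no_SEDF[of G q "2 * b" m k lam D p] prime_odd_nat[of p]
    by (simp add: exact_power_dvd_multiplicity)
next
  fix p q :: nat and G :: "('a, 'b) monoid_scheme" and D
  assume *: "Factorial_Ring.prime q" "exact_power_dvd q (2 * c) (m - 1) \<or> \<not> q dvd m - 1"
    "Factorial_Ring.prime p" "odd p" "p dvd q ^ (2 * b + 1) + 1" "\<not> p dvd (m - 2) * k"
    "is_SEDF G (q ^ (2 * b + 1) + 1) m k lam D"
  \<comment> \<open>The multiplicity is \<open>2 * c\<close> or 0, while
    \<open>t = 2 * b + 1\<close> is odd.\<close>
  have "even (multiplicity q (m - 1))"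
    using *(2) exact_power_dvd_multiplicity not_dvd_imp_multiplicity_0 by fastforce
  then show False
    using no_SEDF[OF *(7) assms(1) *(3,4,1) _ *(5) _ *(6)] by simp
qed

end
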